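(* Let $\delta>0$, $0<\alpha<2$ and $\beta>0$. Assume that $\alpha\pi/2<\mu<\min\{\pi,\alpha\pi\}$ and $\mu\le|\arg z|\le\pi$. Then there exists a constant $C>0$ only depending on $\mu,\alpha$ and $\beta$ such that $$\left|E^\delta_{\alpha,\beta}(z)\right|\le\frac{C}{1+|z|^\delta}.$$
   Context: Here $z\in\mathbb{C}$, and $E^\delta_{\alpha,\beta}$ is the Prabhakar generalized Mittag-Leffler function, defined by $E^\delta_{\alpha,\beta}(z)=\sum_{n=0}^\infty\frac{(\delta)_n}{n!\,\Gamma(\alpha n+\beta)}z^n$, where $(\delta)_n=\delta(\delta+1)\cdots(\delta+n-1)$ and $\Gamma$ is the gamma function. The argument $\arg z$ is the principal one, with the branch cut along the negative real axis.
   Formalization: The constant C is allowed to depend on δ as well as on μ, α and β; a C independent of δ cannot exist, since for α=β=1 one has x^δ E^δ(−x) → 1/Γ(1−δ), which is unbounded over δ>0. *)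

theory Defs
  imports "HOL-Complex_Analysis.Complex_Analysis"
begin

text \<open>
  For \<open>\<alpha> > 0\<close> the series converges for every complex \<open>z\<close>. If moreover \<open>\<beta> > 0\<close>, the
  argument of \<open>Gamma\<close> is positive, so no term meets a pole of \<open>Gamma\<close>.
\<close>

definition prabhakar :: "real \<Rightarrow> real \<Rightarrow> real \<Rightarrow> complex \<Rightarrow> complex" where
  "prabhakar \<delta> \<alpha> \<beta> z =
     (\<Sum>n. complex_of_real (pochhammer \<delta> n / (fact n * Gamma (\<alpha> * real n + \<beta>))) * z ^ n)"

end

theory Submission
  imports Defs
begin

text \<open>
  Everything rests on the contour integral
  \<open>2 \<pi> i E(z) = \<integral>\<^sub>H e\<^sup>s s\<^sup>-\<^sup>\<beta> (1 - z s\<^sup>-\<^sup>\<alpha>)\<^sup>-\<^sup>\<delta> ds\<close> for \<open>E = prabhakar \<delta> \<alpha> \<beta>\<close>,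
  where \<open>H\<close> is a Hankel contour, coming from infinity along the ray of argument \<open>-\<theta>\<close>, turning around
  the origin and leaving along the ray of argument \<open>\<theta>\<close>, with \<open>\<pi>/2 < \<theta> < \<mu>/\<alpha>\<close>. If \<open>H\<close> stays so far from
  the origin that \<open>\<bar>z s\<^sup>-\<^sup>\<alpha>\<bar> \<le> 1/2\<close>, the formula is the binomial series integrated term by term, each term
  being Hankel's integral for \<open>1/\<Gamma>(\<alpha>n + \<beta>)\<close> (\<open>hankel_formula\<close>). On the other hand, when
  \<open>\<bar>arg z\<bar> \<ge> \<mu> > \<alpha>\<theta>\<close> the number \<open>z s\<^sup>-\<^sup>\<alpha>\<close> keeps a positive angular distance from the positive axis
  for all \<open>\<bar>arg s\<bar> \<le> \<theta>\<close>. The integrand is therefore holomorphic in the whole sector, so that the contour may be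
  moved to one that does not depend on \<open>z\<close>, and there \<open>\<bar>1 - z s\<^sup>-\<^sup>\<alpha>\<bar> \<ge> c max (1, \<bar>z s\<^sup>-\<^sup>\<alpha>\<bar>)\<close>, which
  produces the factor \<open>1 / (1 + \<bar>z\<bar>\<^sup>\<delta>)\<close> (\<open>norm_prabhakar_le\<close> and \<open>norm_one_minus_ge\<close>).

  Two devices keep the analysis elementary. The substitution \<open>s = exp w\<close> turns the sector into the convex
  strip \<open>\<bar>Im w\<bar> \<le> \<theta>\<close>, the rays into horizontal lines and the power \<open>s\<^sup>-\<^sup>\<beta>\<close> into an exponential without a
  branch cut. Moreover no contour integral is ever formed: on a convex strip the integrand has
  a primitive \<open>F\<close>, and the integral along \<open>H\<close> is the limit of \<open>F (R + i\<theta>) - F (R - i\<theta>)\<close> as \<open>R\<close> tends to infinity.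
  Independence of the contour is then automatic, and bounds come from the mean value
  inequality along whichever path is convenient (\<open>hankel_path_bound\<close>).
\<close>

section \<open>The Hankel integrand in the logarithmic variable\<close>

text \<open>
  This is \<open>e\<^sup>s s\<^sup>-\<^sup>b ds\<close> with \<open>s = exp w\<close>; the factor \<open>ds = exp w dw\<close> accounts for \<open>1 - b\<close> in place of \<open>- b\<close>.
\<close>
definition hankel_kernel :: "real \<Rightarrow> complex \<Rightarrow> complex" where
  "hankel_kernel b w = exp (exp w + of_real (1 - b) * w)"

lemma norm_hankel_kernel:
  "norm (hankel_kernel b (Complex x y)) = exp (exp x * cos y + (1 - b) * x)"
  by (simp add: hankel_kernel_def Re_exp)

lemma holomorphic_hankel_kernel [holomorphic_intros]: "hankel_kernel b holomorphic_on S"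
  unfolding hankel_kernel_def by (intro holomorphic_intros)

lemma hankel_kernel_shift: "hankel_kernel (b + c) w = hankel_kernel b w * exp (- of_real c * w)"
  by (simp add: hankel_kernel_def algebra_simps flip: exp_add)

text \<open>
  The simple majorant \<open>exp (- x)\<close> is all that is kept of the doubly exponential decay: it has an explicit
  primitive, which makes the tail of the contour easy to estimate. Any power of \<open>exp x\<close> is absorbed, as
  \<open>(u / n)\<^sup>n \<le> exp u\<close>.
\<close>
lemma exp_exp_decay:
  fixes \<kappa> k :: real
  assumes "\<kappa> > 0"
  shows "\<exists>L>0. \<forall>x\<ge>0. exp (- \<kappa> * exp x + k * x) \<le> L * exp (- x)"
proof -
  obtain n :: nat where n: "max 1 (k + 1) \<le> real n"
    using real_arch_simple by blast
  have "exp (- \<kappa> * exp x + k * x) \<le> (real n / \<kappa>) ^ n * exp (- x)" if "x \<ge> 0" for x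
  proof -
    have "exp ((k + 1) * x) \<le> exp (real n * x)"
      using n that by (auto intro: mult_right_mono)
    also have "\<dots> = (real n / \<kappa>) ^ n * (\<kappa> * exp x / real n) ^ n"
      using n assms by (simp add: exp_of_nat_mult power_mult_distrib[symmetric])
    also have "\<dots> \<le> (real n / \<kappa>) ^ n * exp (\<kappa> * exp x / real n) ^ n"
    proof (intro mult_left_mono power_mono)
      show "\<kappa> * exp x / real n \<le> exp (\<kappa> * exp x / real n)"
        using exp_ge_add_one_self[of "\<kappa> * exp x / real n"] by linarith
    qed (use assms in auto)
    also have "exp (\<kappa> * exp x / real n) ^ n = exp (\<kappa> * exp x)"
      using n by (simp add: exp_of_nat_mult[symmetric])
    finally have "exp ((k + 1) * x) * exp (- \<kappa> * exp x - x)
        \<le> (real n / \<kappa>) ^ n * exp (\<kappa> * exp x) * exp (- \<kappa> * exp x - x)"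
      by (rule mult_right_mono) simp
    also have "\<dots> = (real n / \<kappa>) ^ n * exp (- x)"
      by (simp add: mult.assoc flip: exp_add)
    finally show ?thesis
      by (simp add: algebra_simps flip: exp_add)
  qed
  moreover have "(real n / \<kappa>) ^ n > 0" using n assms by simp
  ultimately show ?thesis by blast
qed

text \<open>
  One constant serves for the two horizontal rays and for the vertical segment that joins their ends.
\<close>
lemma hankel_kernel_decay:
  assumes "cos \<theta> < 0" "a \<ge> 0"
  obtains L where "L > 0"
    "\<And>x. x \<ge> a \<Longrightarrow> norm (hankel_kernel b (Complex x \<theta>)) \<le> L * exp (- x)"
    "\<And>x. x \<ge> a \<Longrightarrow> norm (hankel_kernel b (Complex x (- \<theta>))) \<le> L * exp (- x)"
    "\<And>y. norm (hankel_kernel b (Complex a y)) \<le> L"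
proof -
  obtain L where L: "L > 0" "\<And>x. x \<ge> 0 \<Longrightarrow> exp (- (- cos \<theta>) * exp x + (1 - b) * x) \<le> L * exp (- x)"
    using exp_exp_decay[of "- cos \<theta>" "1 - b"] assms by auto
  define M where "M = max L (exp (exp a + (1 - b) * a))"
  have "norm (hankel_kernel b (Complex a y)) \<le> M" for y
  proof -
    have "exp a * cos y \<le> exp a * 1"
      by (intro mult_left_mono) auto
    then have "norm (hankel_kernel b (Complex a y)) \<le> exp (exp a + (1 - b) * a)"
      by (simp add: norm_hankel_kernel)
    then show ?thesis by (simp add: M_def)
  qed
  moreover have "norm (hankel_kernel b (Complex x t)) \<le> M * exp (- x)"
    if "x \<ge> a" "t = \<theta> \<or> t = - \<theta>" for x t
  proof -
    have "norm (hankel_kernel b (Complex x t)) \<le> L * exp (- x)"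
      using L(2)[of x] that assms(2) by (auto simp: norm_hankel_kernel mult.commute)
    also have "\<dots> \<le> M * exp (- x)"
      by (intro mult_right_mono) (auto simp: M_def)
    finally show ?thesis .
  qed
  moreover have "M > 0" using L(1) by (simp add: M_def)
  ultimately show ?thesis using that by blast
qed

section \<open>Increments of a primitive along a Hankel contour\<close>

lemma vector_derivative_horizontal:
  assumes "(F has_field_derivative D) (at (Complex x y))"
  shows "((\<lambda>t. F (Complex t y)) has_vector_derivative D) (at x)"
proof -
  have "((\<lambda>t. Complex t y) has_vector_derivative 1) (at x)"
    unfolding Complex_eq by (auto intro!: derivative_eq_intros)
  from field_vector_diff_chain_at[OF this] assms show ?thesis
    by (simp add: o_def)
qed

lemma horizontal_increment_bound:
  fixes F f :: "complex \<Rightarrow> complex"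
  assumes deriv: "\<And>x. x \<ge> a \<Longrightarrow> (F has_field_derivative f (Complex x y)) (at (Complex x y))"
    and bound: "\<And>x. x \<ge> a \<Longrightarrow> norm (f (Complex x y)) \<le> B * exp (- x)"
    and "B \<ge> 0" "a \<ge> 0" "a \<le> R"
  shows "norm (F (Complex R y) - F (Complex a y)) \<le> B"
proof (cases "a = R")
  case False
  have "norm (F (Complex R y) - F (Complex a y)) \<le> - B * exp (- R) - (- B * exp (- a))"
  proof (rule differentiable_bound_general[where \<phi>' = "\<lambda>x. B * exp (- x)"
        and f' = "\<lambda>x. f (Complex x y)"])
    show "a < R" using False assms by simp
    show "continuous_on {a..R} (\<lambda>x. F (Complex x y))"
      by (intro continuous_at_imp_continuous_on ballI has_vector_derivative_continuous
          [OF vector_derivative_horizontal[OF deriv]]) auto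
    show "((\<lambda>x. - B * exp (- x)) has_vector_derivative B * exp (- x)) (at x)" for x
      unfolding has_real_derivative_iff_has_vector_derivative[symmetric]
      by (auto intro!: derivative_eq_intros)
  qed (auto intro!: continuous_intros vector_derivative_horizontal deriv bound)
  also have "\<dots> \<le> B * exp (- a)" using \<open>B \<ge> 0\<close> by simp
  also have "\<dots> \<le> B" using assms by (simp add: mult_left_le)
  finally show ?thesis .
qed (use assms in auto)

lemma vertical_increment_bound:
  fixes F f :: "complex \<Rightarrow> complex"
  assumes deriv: "\<And>y. y \<in> {u..v} \<Longrightarrow> (F has_field_derivative f (Complex x y)) (at (Complex x y))"
    and bound: "\<And>y. y \<in> {u..v} \<Longrightarrow> norm (f (Complex x y)) \<le> B" and "u \<le> v"
  shows "norm (F (Complex x v) - F (Complex x u)) \<le> B * (v - u)"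
proof -
  let ?S = "closed_segment (Complex x u) (Complex x v)"
  have S: "\<exists>y\<in>{u..v}. w = Complex x y" if "w \<in> ?S" for w
    using that \<open>u \<le> v\<close> by (intro bexI[of _ "Im w"])
      (auto simp: closed_segment_same_Re complex_eq_iff closed_segment_eq_real_ivl)
  have "norm (F (Complex x v) - F (Complex x u)) \<le> B * norm (Complex x v - Complex x u)"
    by (rule field_differentiable_bound[where S = ?S and f' = f])
      (use S deriv bound in \<open>auto intro: has_field_derivative_at_within dest!: S\<close>)
  also have "norm (Complex x v - Complex x u) = v - u"
    using \<open>u \<le> v\<close> by (simp add: cmod_def)
  finally show ?thesis .
qed

text \<open>
  The two end points are joined by the path that runs left along the lower line to abscissa \<open>a\<close>, up the vertical
  segment and back right along the upper line. The bound does not depend on \<open>R\<close>, hence it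
  also bounds the integral over the infinite contour.
\<close>
lemma hankel_path_bound:
  fixes F f :: "complex \<Rightarrow> complex"
  assumes deriv: "\<And>w. \<bar>Im w\<bar> \<le> \<theta> \<Longrightarrow> Re w \<ge> a \<Longrightarrow> (F has_field_derivative f w) (at w)"
    and upper: "\<And>x. x \<ge> a \<Longrightarrow> norm (f (Complex x \<theta>)) \<le> B * exp (- x)"
    and lower: "\<And>x. x \<ge> a \<Longrightarrow> norm (f (Complex x (- \<theta>))) \<le> B * exp (- x)"
    and vertical: "\<And>y. \<bar>y\<bar> \<le> \<theta> \<Longrightarrow> norm (f (Complex a y)) \<le> B"
    and "\<theta> \<ge> 0" "a \<ge> 0" "a \<le> R"
  shows "norm (F (Complex R \<theta>) - F (Complex R (- \<theta>))) \<le> (2 * \<theta> + 2) * B"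
proof -
  have "0 \<le> norm (f (Complex a 0))" by simp
  also have "\<dots> \<le> B" using vertical[of 0] \<open>\<theta> \<ge> 0\<close> by simp
  finally have B: "B \<ge> 0" .
  have 1: "norm (F (Complex R \<theta>) - F (Complex a \<theta>)) \<le> B"
    using assms B by (intro horizontal_increment_bound[where f = f]) auto
  have 2: "norm (F (Complex R (- \<theta>)) - F (Complex a (- \<theta>))) \<le> B"
    using assms B by (intro horizontal_increment_bound[where f = f]) auto
  have 3: "norm (F (Complex a \<theta>) - F (Complex a (- \<theta>))) \<le> B * (\<theta> - (- \<theta>))"
    using assms by (intro vertical_increment_bound[where f = f]) auto
  have "F (Complex R \<theta>) - F (Complex R (- \<theta>)) =
      (F (Complex R \<theta>) - F (Complex a \<theta>)) + (F (Complex a \<theta>) - F (Complex a (- \<theta>)))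
      - (F (Complex R (- \<theta>)) - F (Complex a (- \<theta>)))" by simp
  also have "norm \<dots> \<le> B + B * (\<theta> - (- \<theta>)) + B"
    by (intro order_trans[OF norm_triangle_ineq4] order_trans[OF norm_triangle_ineq] add_mono 1 2 3)
  finally show ?thesis by (simp add: algebra_simps)
qed


section \<open>Hankel's formula for the reciprocal Gamma function\<close>

text \<open>
  Vertical segments carry no weight in the limit, to the right as long as \<open>cos\<close> is negative on them, and to the
  left when \<open>b < 1\<close>. The filter \<open>G\<close> stands for \<open>at_top\<close> or \<open>at_bot\<close> accordingly.
\<close>
lemma increment_tendsto_0:
  fixes F :: "complex \<Rightarrow> complex"
  assumes deriv: "\<And>w. (F has_field_derivative hankel_kernel b w) (at w)"
    and "u \<le> v" and "\<And>y. y \<in> {u..v} \<Longrightarrow> cos y \<le> c" 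
    and lim: "((\<lambda>x. exp (exp x * c + (1 - b) * x)) \<longlongrightarrow> 0) G"
  shows "((\<lambda>x. F (Complex x v) - F (Complex x u)) \<longlongrightarrow> 0) G"
proof (rule Lim_null_comparison)
  show "eventually (\<lambda>x. norm (F (Complex x v) - F (Complex x u))
      \<le> exp (exp x * c + (1 - b) * x) * (v - u)) G"
    using assms(2,3) by (intro always_eventually allI vertical_increment_bound[OF deriv])
      (auto simp: norm_hankel_kernel)
  show "((\<lambda>x. exp (exp x * c + (1 - b) * x) * (v - u)) \<longlongrightarrow> 0) G"
    using tendsto_mult_left_zero[OF lim] .
qed

lemma exp_exp_tendsto_0:
  fixes c k :: real
  assumes "c < 0"
  shows "((\<lambda>x. exp (exp x * c + k * x)) \<longlongrightarrow> 0) at_top"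
proof -
  obtain L where L: "L > 0" "\<And>x. x \<ge> 0 \<Longrightarrow> exp (- (- c) * exp x + k * x) \<le> L * exp (- x)"
    using exp_exp_decay[of "- c" k] assms by auto
  show ?thesis
  proof (rule Lim_null_comparison)
    show "eventually (\<lambda>x. norm (exp (exp x * c + k * x)) \<le> L * exp (- x)) at_top"
      using eventually_ge_at_top[of 0] by eventually_elim (use L(2) in \<open>simp add: mult.commute\<close>)
    have "((\<lambda>x::real. exp (- x)) \<longlongrightarrow> 0) at_top"
      by (rule filterlim_compose[OF exp_at_bot filterlim_uminus_at_bot_at_top])
    then show "((\<lambda>x. L * exp (- x)) \<longlongrightarrow> 0) at_top"
      by (rule tendsto_mult_right_zero)
  qed
qed

lemma Gamma_integral_tendsto:
  assumes "x > (0::real)"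
  shows "((\<lambda>T. integral {0..T} (\<lambda>t. t powr (x - 1) / exp t)) \<longlongrightarrow> Gamma x) at_top"
proof -
  let ?f = "\<lambda>t::real. t powr (x - 1) / exp t"
  have "?f absolutely_integrable_on {0..}"
    using Gamma_integral_real[OF assms]
    by (intro nonnegative_absolutely_integrable_1) (auto simp: integrable_on_def)
  then have int: "set_integrable lebesgue {0..} ?f" by simp
  have "((\<lambda>T. LINT t:{0..T}|lebesgue. ?f t) \<longlongrightarrow> (LINT t:{0..}|lebesgue. ?f t)) at_top"
    by (intro tendsto_set_lebesgue_integral_at_top int) auto
  moreover have "(LINT t:{0..T}|lebesgue. ?f t) = integral {0..T} ?f" for T
    by (intro set_lebesgue_integral_eq_integral set_integrable_subset[OF int]) auto
  moreover have "(LINT t:{0..}|lebesgue. ?f t) = Gamma x"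
    using set_lebesgue_integral_eq_integral(2)[OF int] Gamma_integral_real[OF assms]
    by (simp add: integral_unique)
  ultimately show ?thesis by simp
qed

text \<open>
  The lines \<open>Im w = \<plusminus> \<pi>\<close> are the two banks of the negative \<open>s\<close>-axis. The exponential agrees there,
  and the powers differ by the phase that yields the sine of the reflection formula.
\<close>
lemma hankel_kernel_on_cut:
  "hankel_kernel b (Complex x pi) - hankel_kernel b (Complex x (- pi)) =
     of_real (exp (- exp x + (1 - b) * x)) * (2 * \<i> * of_real (sin (pi * b)))"
proof -
  have "exp (Complex x pi) = of_real (- exp x)" "exp (Complex x (- pi)) = of_real (- exp x)"
    by (simp_all add: complex_eq_iff Re_exp Im_exp)
  then have *: "hankel_kernel b (Complex x t) =
     of_real (exp (- exp x + (1 - b) * x)) * cis ((1 - b) * t)" if "t = pi \<or> t = - pi" for t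
    using that by (auto simp: hankel_kernel_def complex_eq_iff Re_exp Im_exp)
  have "sin ((1 - b) * pi) = sin (pi * b)"
    using sin_diff[of pi "pi * b"] by (simp add: algebra_simps)
  then show ?thesis
    by (simp add: * complex_eq_iff)
qed

text \<open>
  For \<open>b < 1\<close> the contour can be collapsed onto the cut: the vertical part disappears at \<open>- \<infinity>\<close>, and the jump
  across the cut integrates to \<open>2 i sin (\<pi> b) \<Gamma>(1 - b)\<close>, which is \<open>2 \<pi> i / \<Gamma>(b)\<close> by reflection.
\<close>
lemma hankel_formula_cut_lt_1:
  fixes F :: "complex \<Rightarrow> complex"
  assumes deriv: "\<And>w. (F has_field_derivative hankel_kernel b w) (at w)" and b: "0 < b" "b < 1"
  shows "((\<lambda>R. F (Complex R pi) - F (Complex R (- pi))) \<longlongrightarrow> 2 * pi * \<i> * rGamma (of_real b)) at_top"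
proof -
  define J where "J x = F (Complex x pi) - F (Complex x (- pi))" for x
  define c where "c = 2 * \<i> * of_real (sin (pi * b))"
  define f where "f t = t powr (1 - b - 1) / exp t" for t :: real
  have "((\<lambda>x. exp (exp x * 1 + (1 - b) * x)) \<longlongrightarrow> 0) at_bot"
  proof -
    have "filterlim (\<lambda>x. (1 - b) * x) at_bot at_bot"
      using b by (intro filterlim_tendsto_pos_mult_at_bot[OF tendsto_const] filterlim_ident) auto
    then have "((\<lambda>x. exp ((1 - b) * x)) \<longlongrightarrow> 0) at_bot"
      by (rule filterlim_compose[OF exp_at_bot])
    from tendsto_mult[OF tendsto_exp[OF exp_at_bot] this] show ?thesis
      by (simp add: exp_add)
  qed
  then have J_bot: "(J \<longlongrightarrow> 0) at_bot"
    unfolding J_def using deriv by (intro increment_tendsto_0[where c = 1]) auto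
  have J': "(J has_vector_derivative of_real (exp (- exp x + (1 - b) * x)) * c) (at x)" for x
    unfolding J_def c_def hankel_kernel_on_cut[symmetric]
    by (intro derivative_intros vector_derivative_horizontal deriv)
  \<comment> \<open>In the variable \<open>t = exp x\<close> the derivative of the increment is Euler's integrand. Continuity at \<open>0\<close>
     with value \<open>0\<close> is the statement that the vertical part disappears.\<close>
  define K where "K t = (if t \<le> 0 then 0 else J (ln t))" for t
  have K': "(K has_vector_derivative of_real (f t) * c) (at t)" if "t > 0" for t
  proof -
    have "((J \<circ> ln) has_vector_derivative (1 / t) *\<^sub>R (of_real (exp (- exp (ln t) + (1 - b) * ln t)) * c)) (at t)"
      using that by (intro vector_diff_chain_at J')
        (auto intro!: derivative_eq_intros simp flip: has_real_derivative_iff_has_vector_derivative)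
    moreover have "(1 / t) * exp (- exp (ln t) + (1 - b) * ln t) = f t"
      using that by (simp add: f_def powr_def exp_add exp_diff exp_minus field_simps)
    ultimately have "((J \<circ> ln) has_vector_derivative of_real (f t) * c) (at t)"
      by (simp only: scaleR_conv_of_real mult.assoc[symmetric] of_real_mult[symmetric])
    then show ?thesis
      by (rule has_vector_derivative_transform_within_open[where S = "{0<..}"])
        (use that in \<open>auto simp: K_def\<close>)
  qed
  have K_eq: "K T = of_real (integral {0..T} f) * c" if "T > 0" for T
  proof -
    have "continuous_on {0..T} K"
      unfolding continuous_on_eq_continuous_within
    proof
      fix t assume t: "t \<in> {0..T}"
      show "continuous (at t within {0..T}) K"
      proof (cases "t = 0")
        case True
        have "((\<lambda>t. J (ln t)) \<longlongrightarrow> 0) (at_right 0)"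
          by (rule filterlim_compose[OF J_bot ln_at_0])
        then have "(K \<longlongrightarrow> 0) (at_right 0)"
          by (rule Lim_transform_eventually)
            (auto simp: K_def eventually_at_right_less eventually_mono[OF eventually_at_right_less])
        then have "(K \<longlongrightarrow> 0) (at 0 within {0..T})"
          using that by (simp add: at_within_Icc_at_right)
        then show ?thesis
          using True by (simp add: continuous_within K_def)
      next
        case False
        then show ?thesis
          using t has_vector_derivative_continuous[OF K', of t]
          by (simp add: continuous_at_imp_continuous_within)
      qed
    qed
    then have 1: "((\<lambda>t. of_real (f t) * c) has_integral (K T - K 0)) {0..T}"
      using that K' by (intro fundamental_theorem_of_calculus_interior) auto
    have "f integrable_on {0..T}"
      unfolding f_def using Gamma_integral_real[of "1 - b"] b
      by (intro integrable_on_subinterval[of _ "{0..}"]) (auto simp: integrable_on_def)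
    from has_integral_mult_left[OF has_integral_of_real[OF integrable_integral[OF this]], of c]
    have "((\<lambda>t. of_real (f t) * c) has_integral (of_real (integral {0..T} f) * c)) {0..T}" .
    with 1 show ?thesis by (simp add: K_def has_integral_unique)
  qed
  have "((\<lambda>T. of_real (integral {0..T} f) * c) \<longlongrightarrow> of_real (Gamma (1 - b)) * c) at_top"
    unfolding f_def using b by (intro tendsto_intros Gamma_integral_tendsto) auto
  then have "((\<lambda>R. of_real (integral {0..exp R} f) * c) \<longlongrightarrow> of_real (Gamma (1 - b)) * c) at_top"
    by (rule filterlim_compose) (rule exp_at_top)
  moreover have "of_real (integral {0..exp R} f) * c = J R" for R
    using K_eq[of "exp R"] by (simp add: K_def)
  moreover have "of_real (Gamma (1 - b)) * c = 2 * pi * \<i> * rGamma (of_real b)"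
  proof -
    have "complex_of_real (Gamma b * Gamma (1 - b)) = of_real (pi / sin (pi * b))"
      using Gamma_reflection_complex[of "of_real b"] by (simp flip: Gamma_complex_of_real sin_of_real)
    then have "Gamma b * Gamma (1 - b) = pi / sin (pi * b)"
      by (simp only: of_real_eq_iff)
    moreover have "sin (pi * b) > 0" using b by (intro sin_gt_zero) auto
    moreover have "Gamma b > 0" using b by simp
    ultimately have "Gamma (1 - b) * sin (pi * b) = pi * rGamma b"
      by (simp add: rGamma_inverse_Gamma field_simps)
    then have "complex_of_real (Gamma (1 - b) * sin (pi * b)) = of_real (pi * rGamma b)" by simp
    then show ?thesis by (simp add: c_def rGamma_complex_of_real)
  qed
  ultimately show ?thesis by (simp add: J_def)
qed

text \<open>
  At \<open>b = 1\<close> the integrand no longer decays to the left, and the recurrence from \<open>b = 0\<close> would be \<open>0 = 0\<close>.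
  Here the jump across the cut vanishes, so the increment is constant, and its value is \<open>2 \<pi> i\<close>
  times the residue of \<open>e\<^sup>s / s\<close> at \<open>0\<close>:
  far to the left the integrand in \<open>w\<close> approaches \<open>1\<close>, whose primitive is \<open>w\<close>.
\<close>
lemma hankel_formula_cut_1:
  fixes F :: "complex \<Rightarrow> complex"
  assumes deriv: "\<And>w. (F has_field_derivative hankel_kernel 1 w) (at w)"
  shows "F (Complex R pi) - F (Complex R (- pi)) = 2 * pi * \<i>"
proof -
  define J where "J x = F (Complex x pi) - F (Complex x (- pi)) - 2 * pi * \<i>" for x
  have "(J has_vector_derivative (0 - 0)) (at x)" for x
  proof -
    have "(J has_vector_derivative (hankel_kernel 1 (Complex x pi) - hankel_kernel 1 (Complex x (- pi)) - 0)) (at x)"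
      unfolding J_def by (intro derivative_intros vector_derivative_horizontal deriv)
    then show ?thesis using hankel_kernel_on_cut[of 1 x] by simp
  qed
  then obtain d where d: "J x = d" for x
    using has_vector_derivative_zero_constant[of UNIV J] by auto
  have "norm (J x) \<le> (exp (exp x) * exp x) * (2 * pi)" for x
  proof -
    have "norm ((F (Complex x pi) - Complex x pi) - (F (Complex x (- pi)) - Complex x (- pi)))
        \<le> (exp (exp x) * exp x) * (pi - (- pi))"
    proof (rule vertical_increment_bound)
      show "((\<lambda>w. F w - w) has_field_derivative (exp (exp w) - 1)) (at w)" for w
        using DERIV_diff[OF deriv DERIV_ident, of w] by (simp add: hankel_kernel_def)
      show "norm (exp (exp (Complex x y)) - 1) \<le> exp (exp x) * exp x" for y
        using Taylor_exp_field[of "exp (Complex x y)" 0] by simp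
    qed auto
    moreover have "(F (Complex x pi) - Complex x pi) - (F (Complex x (- pi)) - Complex x (- pi)) = J x"
      by (simp add: J_def complex_eq_iff)
    ultimately show ?thesis by simp
  qed
  then have "norm d \<le> (exp (exp x) * exp x) * (2 * pi)" for x
    by (simp add: d)
  moreover have "((\<lambda>x::real. (exp (exp x) * exp x) * (2 * pi)) \<longlongrightarrow> (exp 0 * 0) * (2 * pi)) at_bot"
    by (intro tendsto_intros exp_at_bot)
  ultimately have "norm d \<le> (exp 0 * 0) * (2 * pi)"
    by (intro tendsto_lowerbound) auto
  then show ?thesis using d[of R] by (simp add: J_def)
qed

text \<open>
  Integration by parts is the counterpart of \<open>\<Gamma>(b + 1) = b \<Gamma>(b)\<close>: the kernel with parameter \<open>b\<close> is the derivative
  of the kernel with parameter \<open>b + 1\<close>, plus \<open>b\<close> times that kernel.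
\<close>
lemma hankel_formula_step:
  fixes F :: "complex \<Rightarrow> complex"
  assumes deriv: "\<And>w. (F has_field_derivative hankel_kernel (b + 1) w) (at w)"
    and "cos \<theta> < 0" "b > 0"
    and IH: "\<And>F. (\<And>w. (F has_field_derivative hankel_kernel b w) (at w)) \<Longrightarrow>
      ((\<lambda>R. F (Complex R \<theta>) - F (Complex R (- \<theta>))) \<longlongrightarrow> 2 * pi * \<i> * rGamma (of_real b)) at_top"
  shows "((\<lambda>R. F (Complex R \<theta>) - F (Complex R (- \<theta>))) \<longlongrightarrow> 2 * pi * \<i> * rGamma (of_real (b + 1))) at_top"
proof -
  let ?k = "hankel_kernel (b + 1)"
  define P where "P w = ?k w + of_real b * F w" for w
  have "(P has_field_derivative hankel_kernel b w) (at w)" for w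
  proof -
    have "(?k has_field_derivative ?k w * (exp w - of_real b)) (at w)"
      unfolding hankel_kernel_def by (auto intro!: derivative_eq_intros simp: mult.commute)
    then have "(P has_field_derivative ?k w * (exp w - of_real b) + of_real b * ?k w) (at w)"
      unfolding P_def by (intro DERIV_add DERIV_cmult deriv)
    moreover have "?k w * (exp w - of_real b) + of_real b * ?k w = hankel_kernel b w"
      using hankel_kernel_shift[of "b + 1" "- 1" w] by (simp add: algebra_simps)
    ultimately show ?thesis by simp
  qed
  then have lim: "((\<lambda>R. P (Complex R \<theta>) - P (Complex R (- \<theta>))) \<longlongrightarrow> 2 * pi * \<i> * rGamma (of_real b)) at_top"
    by (rule IH)
  have k: "((\<lambda>R. ?k (Complex R t)) \<longlongrightarrow> 0) at_top" if "t = \<theta> \<or> t = - \<theta>" for t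
  proof (rule tendsto_norm_zero_cancel)
    show "((\<lambda>R. norm (?k (Complex R t))) \<longlongrightarrow> 0) at_top"
      using exp_exp_tendsto_0[of "cos \<theta>" "1 - (b + 1)"] that assms(2)
      by (auto simp: norm_hankel_kernel)
  qed
  have "((\<lambda>R. (P (Complex R \<theta>) - P (Complex R (- \<theta>)) - ?k (Complex R \<theta>) + ?k (Complex R (- \<theta>))) / of_real b)
      \<longlongrightarrow> (2 * pi * \<i> * rGamma (of_real b) - 0 + 0) / of_real b) at_top"
    using \<open>b > 0\<close> by (intro tendsto_intros lim k) auto
  moreover have "(P (Complex R \<theta>) - P (Complex R (- \<theta>)) - ?k (Complex R \<theta>) + ?k (Complex R (- \<theta>))) / of_real b
      = F (Complex R \<theta>) - F (Complex R (- \<theta>))" for R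
    using \<open>b > 0\<close> by (simp add: P_def field_simps)
  moreover have "(2 * pi * \<i> * rGamma (of_real b) - 0 + 0) / of_real b = 2 * pi * \<i> * rGamma (of_real (b + 1))"
    using \<open>b > 0\<close> rGamma_plus1[of "complex_of_real b"] by (simp add: field_simps)
  ultimately show ?thesis by simp
qed

lemma hankel_formula_cut:
  fixes F :: "complex \<Rightarrow> complex"
  assumes "\<And>w. (F has_field_derivative hankel_kernel b w) (at w)" "0 < b"
  shows "((\<lambda>R. F (Complex R pi) - F (Complex R (- pi))) \<longlongrightarrow> 2 * pi * \<i> * rGamma (of_real b)) at_top"
proof -
  have "\<forall>F. (\<forall>w. (F has_field_derivative hankel_kernel b w) (at w)) \<longrightarrow>
      ((\<lambda>R. F (Complex R pi) - F (Complex R (- pi))) \<longlongrightarrow> 2 * pi * \<i> * rGamma (of_real b)) at_top"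
    if "0 < b" "b \<le> real n" for n b
    using that
  proof (induction n arbitrary: b)
    case (Suc n)
    show ?case
    proof (cases "b \<le> 1")
      case True
      then consider "b < 1" | "b = 1" by linarith
      then show ?thesis
      proof cases
        case 1
        then show ?thesis using hankel_formula_cut_lt_1 Suc.prems by blast
      next
        case 2
        then show ?thesis by (auto simp: hankel_formula_cut_1)
      qed
    next
      case False
      then have "\<forall>F. (\<forall>w. (F has_field_derivative hankel_kernel (b - 1) w) (at w)) \<longrightarrow>
        ((\<lambda>R. F (Complex R pi) - F (Complex R (- pi))) \<longlongrightarrow> 2 * pi * \<i> * rGamma (of_real (b - 1))) at_top"
        using Suc.prems by (intro Suc.IH) auto
      then show ?thesis
        using hankel_formula_step[of _ "b - 1" pi] False by auto
    qed
  qed auto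
  from this[of b "nat \<lceil>b\<rceil>"] assms show ?thesis by (auto simp: real_nat_ceiling_ge)
qed

text \<open>
  The integrand is entire in \<open>w\<close>, so the rays may be turned from the cut to any angle beyond \<open>\<pi>/2\<close>: the
  vertical segments between the old and the new lines lie where the cosine is negative.
\<close>
lemma hankel_formula:
  fixes F :: "complex \<Rightarrow> complex"
  assumes deriv: "\<And>w. (F has_field_derivative hankel_kernel b w) (at w)"
    and "0 < b" and \<theta>: "pi / 2 < \<theta>" "\<theta> \<le> pi"
  shows "((\<lambda>R. F (Complex R \<theta>) - F (Complex R (- \<theta>))) \<longlongrightarrow> 2 * pi * \<i> * rGamma (of_real b)) at_top"
proof -
  have "cos \<theta> < cos (pi / 2)" using \<theta> by (intro cos_monotone_0_pi) auto
  then have "cos \<theta> < 0" by simp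
  note lim0 = exp_exp_tendsto_0[OF this]
  have 1: "((\<lambda>x. F (Complex x pi) - F (Complex x \<theta>)) \<longlongrightarrow> 0) at_top"
    using \<theta> by (intro increment_tendsto_0[OF deriv _ _ lim0] cos_monotone_0_pi_le) auto
  have cos2: "cos y \<le> cos \<theta>" if "y \<in> {- pi..- \<theta>}" for y
    using cos_monotone_0_pi_le[of \<theta> "- y"] that \<theta> by simp
  have 2: "((\<lambda>x. F (Complex x (- \<theta>)) - F (Complex x (- pi))) \<longlongrightarrow> 0) at_top"
    using \<theta> by (intro increment_tendsto_0[OF deriv _ _ lim0] cos2) auto
  from tendsto_diff[OF tendsto_diff[OF hankel_formula_cut[OF deriv \<open>0 < b\<close>] 1] 2]
  show ?thesis by simp
qed


lemma entire_primitive_hankel_kernel: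
  obtains F where "\<And>w. (F has_field_derivative hankel_kernel b w) (at w)"
  using holomorphic_convex_primitive'[OF convex_UNIV open_UNIV holomorphic_hankel_kernel[of b]]
  by auto

section \<open>Separation from the branch point\<close>

text \<open>
  The hypothesis keeps \<open>\<zeta>\<close> out of a cone around the positive axis, so that \<open>1\<close> and \<open>- \<zeta>\<close> cannot cancel: the
  square of the left-hand side is at most \<open>(1 - k) * (1 + \<bar>\<zeta>\<bar>\<^sup>2)\<close>, and \<open>2 \<bar>\<zeta>\<bar> \<le> 1 + \<bar>\<zeta>\<bar>\<^sup>2\<close>.
\<close>
lemma norm_one_minus_ge:
  fixes \<zeta> :: complex
  assumes "0 \<le> k" "k < 1" "Re \<zeta> \<le> k * norm \<zeta>"
  shows "sqrt (1 - k) * max 1 (norm \<zeta>) \<le> norm (1 - \<zeta>)"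
proof (rule power2_le_imp_le)
  have "(sqrt (1 - k) * max 1 (norm \<zeta>))\<^sup>2 = (1 - k) * (max 1 (norm \<zeta>))\<^sup>2"
    using assms by (simp add: power_mult_distrib)
  also have "\<dots> \<le> (1 - k) * (1 + (norm \<zeta>)\<^sup>2)"
    using assms by (intro mult_left_mono) (auto simp: max_def)
  also have "\<dots> \<le> 1 + (norm \<zeta>)\<^sup>2 - 2 * (k * norm \<zeta>)"
  proof -
    have "0 \<le> k * (norm \<zeta> - 1)\<^sup>2" using assms by simp
    then show ?thesis by (simp add: power2_eq_square algebra_simps)
  qed
  also have "\<dots> \<le> 1 + (norm \<zeta>)\<^sup>2 - 2 * Re \<zeta>" using assms by simp
  also have "\<dots> = (norm (1 - \<zeta>))\<^sup>2"
    by (simp only: cmod_power2) (simp add: power2_eq_square algebra_simps)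
  finally show "(sqrt (1 - k) * max 1 (norm \<zeta>))\<^sup>2 \<le> (norm (1 - \<zeta>))\<^sup>2" .
qed simp

text \<open>
  The argument of \<open>z * exp (- \<alpha> * w)\<close> is \<open>Arg z - \<alpha> * Im w\<close>. The absolute value of this angle lies between \<open>\<mu> - t\<close> and \<open>\<pi> + t\<close>, hence
  it is at distance at least \<open>\<mu> - t\<close> from every multiple of \<open>2 \<pi>\<close>, because \<open>\<mu> \<le> \<pi>\<close>.
\<close>
lemma Re_times_exp_le:
  assumes "\<mu> \<le> \<bar>Arg z\<bar>" "\<mu> \<le> pi" "\<alpha> \<ge> 0" "\<alpha> * \<bar>Im w\<bar> \<le> t" "t \<le> \<mu>"
  shows "Re (z * exp (- of_real \<alpha> * w)) \<le> cos (\<mu> - t) * norm (z * exp (- of_real \<alpha> * w))"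
proof -
  define \<phi> where "\<phi> = Arg z - \<alpha> * Im w"
  have "z * exp (- of_real \<alpha> * w) = of_real (norm z * exp (- \<alpha> * Re w)) * cis \<phi>"
  proof -
    have "exp (- of_real \<alpha> * w) = of_real (exp (- \<alpha> * Re w)) * cis (- \<alpha> * Im w)"
      by (simp add: complex_eq_iff Re_exp Im_exp)
    moreover have "z = of_real (norm z) * cis (Arg z)"
      using rcis_cmod_Arg[of z] by (simp add: rcis_def)
    ultimately have "z * exp (- of_real \<alpha> * w) =
        of_real (norm z) * cis (Arg z) * (of_real (exp (- \<alpha> * Re w)) * cis (- \<alpha> * Im w))"
      by simp
    also have "\<dots> = of_real (norm z * exp (- \<alpha> * Re w)) * (cis (Arg z) * cis (- \<alpha> * Im w))"
      by simp
    finally show ?thesis by (simp add: cis_mult \<phi>_def)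
  qed
  moreover have "cos \<phi> \<le> cos (\<mu> - t)"
  proof -
    have le: "\<bar>\<alpha> * Im w\<bar> \<le> t" using assms by (simp add: abs_mult)
    have Arg: "\<bar>Arg z\<bar> \<le> pi" using mpi_less_Arg[of z] Arg_le_pi[of z] by linarith
    show ?thesis
    proof (cases "\<bar>\<phi>\<bar> \<le> pi")
      case True
      have "cos \<bar>\<phi>\<bar> \<le> cos (\<mu> - t)"
        using True le assms by (intro cos_monotone_0_pi_le) (auto simp: \<phi>_def)
      then show ?thesis by simp
    next
      case False
      have "cos (2 * pi - \<bar>\<phi>\<bar>) \<le> cos (\<mu> - t)"
        using False le assms Arg by (intro cos_monotone_0_pi_le) (auto simp: \<phi>_def)
      then show ?thesis by (simp add: cos_diff)
    qed
  qed
  ultimately show ?thesis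
    by (simp add: norm_mult mult.commute[of "cos (\<mu> - t)"] mult_left_mono)
qed

section \<open>The contour integral of the Prabhakar function\<close>

lemma negative_binomial_partial_sums:
  fixes \<delta> :: real
  defines "c \<equiv> \<lambda>n. pochhammer \<delta> n / fact n"
  assumes "\<delta> > 0"
  shows "summable (\<lambda>n. c n * (1 / 2) ^ n)"
    and "\<And>(\<zeta>::complex) N. norm \<zeta> \<le> 1 / 2 \<Longrightarrow>
      norm ((1 - \<zeta>) powr of_real (- \<delta>) - (\<Sum>n<N. of_real (c n) * \<zeta> ^ n))
        \<le> (\<Sum>n. c (n + N) * (1 / 2) ^ (n + N))"
proof -
  have sums: "(\<lambda>n. of_real (c n) * \<zeta> ^ n) sums ((1 - \<zeta>) powr of_real (- \<delta>))"
    if "norm \<zeta> < 1" for \<zeta> :: complex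
  proof -
    have "(of_real (- \<delta>) gchoose n) * (- \<zeta>) ^ n = of_real (c n) * \<zeta> ^ n" for n
    proof -
      have "(of_real (- \<delta>) gchoose n :: complex) = (- 1) ^ n * of_real (c n)"
        by (simp add: gbinomial_pochhammer c_def pochhammer_of_real)
      moreover have "(- 1) ^ n * (- \<zeta>) ^ n = \<zeta> ^ n"
        by (simp flip: power_mult_distrib)
      ultimately show ?thesis by (metis mult.commute mult.assoc)
    qed
    with gen_binomial_complex[of "- \<zeta>" "of_real (- \<delta>)"] that show ?thesis by simp
  qed
  have c: "c n \<ge> 0" for n
    using assms pochhammer_pos[of \<delta> n] by (simp add: c_def)
  have "summable (\<lambda>n. complex_of_real (c n) * of_real (1 / 2) ^ n)"
    using sums[of "of_real (1 / 2)"] by (intro sums_summable) auto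
  then have "summable (\<lambda>n. complex_of_real (c n * (1 / 2) ^ n))" by simp
  then show summ: "summable (\<lambda>n. c n * (1 / 2) ^ n)"
    by (simp only: summable_complex_of_real)
  fix \<zeta> :: complex and N
  assume \<zeta>: "norm \<zeta> \<le> 1 / 2"
  let ?f = "\<lambda>n. of_real (c n) * \<zeta> ^ n"
  have "?f sums ((1 - \<zeta>) powr of_real (- \<delta>))" using \<zeta> by (intro sums) auto
  then have "(\<lambda>n. ?f (n + N)) sums ((1 - \<zeta>) powr of_real (- \<delta>) - (\<Sum>n<N. ?f n))"
    by (subst sums_iff_shift) simp
  then have "(1 - \<zeta>) powr of_real (- \<delta>) - (\<Sum>n<N. ?f n) = (\<Sum>n. ?f (n + N))"
    by (rule sums_unique)
  also have "norm \<dots> \<le> (\<Sum>n. c (n + N) * (1 / 2) ^ (n + N))"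
  proof (rule norm_suminf_le)
    show "norm (?f (n + N)) \<le> c (n + N) * (1 / 2) ^ (n + N)" for n
      using c \<zeta> by (simp add: norm_mult norm_power mult_left_mono power_mono del: power_divide)
    show "summable (\<lambda>n. c (n + N) * (1 / 2) ^ (n + N))"
      by (rule summable_ignore_initial_segment[OF summ])
  qed
  finally show "norm ((1 - \<zeta>) powr of_real (- \<delta>) - (\<Sum>n<N. ?f n))
        \<le> (\<Sum>n. c (n + N) * (1 / 2) ^ (n + N))" .
qed

text \<open>
  This is \<open>e\<^sup>s s\<^sup>-\<^sup>\<beta> (1 - z s\<^sup>-\<^sup>\<alpha>)\<^sup>-\<^sup>\<delta> ds\<close> with \<open>s = exp w\<close>.
\<close>
definition prabhakar_kernel :: "real \<Rightarrow> real \<Rightarrow> real \<Rightarrow> complex \<Rightarrow> complex \<Rightarrow> complex" where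
  "prabhakar_kernel \<delta> \<alpha> \<beta> z w =
     hankel_kernel \<beta> w * (1 - z * exp (- of_real \<alpha> * w)) powr of_real (- \<delta>)"

text \<open>
  The integral of the kernel over the contour through \<open>Re w = 0\<close> is at most \<open>(2 \<theta> + 2) * B\<close>, and it is equal to
  \<open>2 \<pi> i\<close> times the Prabhakar function. The proof compares, at finite \<open>R\<close>, the increment of a primitive \<open>F\<close> of
  the kernel with the increment of a primitive \<open>P\<close> of a partial sum of its binomial expansion. Both the convergence of the series
  and the smallness of the difference are read off from a path so far to the right that \<open>z * exp (- \<alpha> * w)\<close> has
  modulus at most \<open>1/2\<close>, where the remainders \<open>e N\<close> are uniform.
\<close>
lemma norm_prabhakar_le:
  fixes \<delta> \<alpha> \<beta> \<theta> m B :: real and z :: complex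
  assumes pos: "\<delta> > 0" "\<alpha> > 0" "\<beta> > 0" and \<theta>: "pi / 2 < \<theta>" "\<theta> \<le> pi" "\<theta> < m"
    and off_cut: "\<And>w. \<bar>Im w\<bar> < m \<Longrightarrow> 1 - z * exp (- of_real \<alpha> * w) \<notin> \<real>\<^sub>\<le>\<^sub>0"
    and upper: "\<And>x. x \<ge> 0 \<Longrightarrow> norm (prabhakar_kernel \<delta> \<alpha> \<beta> z (Complex x \<theta>)) \<le> B * exp (- x)"
    and lower: "\<And>x. x \<ge> 0 \<Longrightarrow> norm (prabhakar_kernel \<delta> \<alpha> \<beta> z (Complex x (- \<theta>))) \<le> B * exp (- x)"
    and vertical: "\<And>y. \<bar>y\<bar> \<le> \<theta> \<Longrightarrow> norm (prabhakar_kernel \<delta> \<alpha> \<beta> z (Complex 0 y)) \<le> B"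
  shows "norm (prabhakar \<delta> \<alpha> \<beta> z) \<le> (\<theta> + 1) / pi * B"
proof -
  let ?K = "prabhakar_kernel \<delta> \<alpha> \<beta> z"
  define S where "S = {w. \<bar>Im w\<bar> < m}"
  have S_eq: "S = {w. Im w < m} \<inter> {w. Im w > - m}" by (auto simp: S_def)
  have "convex S" "open S"
    unfolding S_eq
    by (auto intro!: convex_Int convex_halfspace_Im_lt convex_halfspace_Im_gt
        open_Int open_halfspace_Im_lt open_halfspace_Im_gt)
  moreover have "?K holomorphic_on S"
    unfolding prabhakar_kernel_def using off_cut by (intro holomorphic_intros) (auto simp: S_def)
  ultimately obtain F where "\<And>w. w \<in> S \<Longrightarrow> (F has_field_derivative ?K w) (at w within S)"
    using holomorphic_convex_primitive' by blast
  then have F: "(F has_field_derivative ?K w) (at w)" if "\<bar>Im w\<bar> \<le> \<theta>" for w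
  proof -
    have "w \<in> S" using that \<theta> by (simp add: S_def)
    with \<open>open S\<close> show ?thesis
      using \<open>\<And>w. w \<in> S \<Longrightarrow> (F has_field_derivative ?K w) (at w within S)\<close> by (metis at_within_open)
  qed
  have "\<exists>H. \<forall>w. (H has_field_derivative hankel_kernel (\<beta> + \<alpha> * real n) w) (at w)" for n
    using entire_primitive_hankel_kernel[of "\<beta> + \<alpha> * real n"] by blast
  then obtain H where H: "\<And>n w. (H n has_field_derivative hankel_kernel (\<beta> + \<alpha> * real n) w) (at w)"
    by metis
  \<comment> \<open>With this abscissa \<open>norm z * exp (- \<alpha> * a) = u * exp (- 2 * u)\<close> for \<open>u = norm z\<close>, which is at most \<open>1/2\<close>.\<close>
  define a where "a = 2 * norm z / \<alpha>"
  have "a \<ge> 0" using pos by (simp add: a_def)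
  have small: "norm (z * exp (- of_real \<alpha> * w)) \<le> 1 / 2" if "Re w \<ge> a" for w
  proof -
    have "norm z * exp (- \<alpha> * Re w) \<le> norm z * exp (- \<alpha> * a)"
      using that pos by (intro mult_left_mono) auto
    also have "\<dots> = norm z * exp (- (2 * norm z))" using pos by (simp add: a_def)
    also have "\<dots> \<le> 1 / 2"
    proof -
      have "2 * norm z \<le> exp (2 * norm z)"
        using exp_ge_add_one_self[of "2 * norm z"] by linarith
      then show ?thesis by (simp add: exp_minus field_simps)
    qed
    finally show ?thesis by (simp add: norm_mult)
  qed
  have "cos \<theta> < cos (pi / 2)" using \<theta> by (intro cos_monotone_0_pi) auto
  then have "cos \<theta> < 0" by simp
  then obtain L where L: "L > 0"
    "\<And>x. x \<ge> a \<Longrightarrow> norm (hankel_kernel \<beta> (Complex x \<theta>)) \<le> L * exp (- x)"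
    "\<And>x. x \<ge> a \<Longrightarrow> norm (hankel_kernel \<beta> (Complex x (- \<theta>))) \<le> L * exp (- x)"
    "\<And>y. norm (hankel_kernel \<beta> (Complex a y)) \<le> L"
    using hankel_kernel_decay[of \<theta> a \<beta>] \<open>a \<ge> 0\<close> by metis
  define c where "c n = pochhammer \<delta> n / fact n" for n
  define e where "e N = (\<Sum>n. c (n + N) * (1 / 2) ^ (n + N))" for N
  note binomial = negative_binomial_partial_sums[OF pos(1), folded c_def]
  have c: "c n \<ge> 0" for n
    using pos pochhammer_pos[of \<delta> n] by (simp add: c_def)
  have e_nonneg: "e N \<ge> 0" for N
    unfolding e_def using c by (intro suminf_nonneg summable_ignore_initial_segment binomial(1)) auto
  have e_lim: "e \<longlonglongrightarrow> 0"
    unfolding e_def by (rule suminf_exist_split2[OF binomial(1)])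
  define D where "D f R = f (Complex R \<theta>) - f (Complex R (- \<theta>))" for f :: "complex \<Rightarrow> complex" and R
  have H_term: "hankel_kernel (\<beta> + \<alpha> * real n) w * z ^ n = hankel_kernel \<beta> w * (z * exp (- of_real \<alpha> * w)) ^ n" for n w
    by (simp add: hankel_kernel_shift power_mult_distrib mult_ac flip: exp_of_nat_mult)
  have path_bound: "norm (D f R) \<le> (2 * \<theta> + 2) * (q * L)"
    if "\<And>w. \<bar>Im w\<bar> \<le> \<theta> \<Longrightarrow> (f has_field_derivative hankel_kernel \<beta> w * g w) (at w)"
      "\<And>w. Re w \<ge> a \<Longrightarrow> norm (g w) \<le> q" "q \<ge> 0" "R \<ge> a" for f g q R
  proof -
    have "norm (hankel_kernel \<beta> w * g w) \<le> q * M" if "norm (hankel_kernel \<beta> w) \<le> M" "Re w \<ge> a" for w M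
    proof -
      have "norm (hankel_kernel \<beta> w) * norm (g w) \<le> M * q"
        using that \<open>\<And>w. Re w \<ge> a \<Longrightarrow> norm (g w) \<le> q\<close> norm_ge_zero order_trans
        by (intro mult_mono) blast+
      then show ?thesis by (simp add: norm_mult mult.commute)
    qed
    note bound = this
    show ?thesis
      unfolding D_def
      using that(1,4) \<theta> \<open>a \<ge> 0\<close> L bound[OF L(2)] bound[OF L(3)] bound[OF L(4)]
      by (intro hankel_path_bound[where f = "\<lambda>w. hankel_kernel \<beta> w * g w" and a = a])
        (auto simp: mult.assoc)
  qed
  have H_lim: "((\<lambda>R. D (H n) R) \<longlongrightarrow> 2 * pi * \<i> * rGamma (of_real (\<beta> + \<alpha> * real n))) at_top" for n
    unfolding D_def using pos \<theta> by (intro hankel_formula H) (auto intro: add_pos_nonneg)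
  define G where "G n = of_real (c n) * (rGamma (of_real (\<beta> + \<alpha> * real n)) * z ^ n)" for n
  have "summable G"
  proof (rule summable_comparison_test_ev)
    have coeff: "norm (2 * pi * \<i> * rGamma (of_real (\<beta> + \<alpha> * real n)) * z ^ n) \<le> (2 * \<theta> + 2) * ((1 / 2) ^ n * L)" for n
    proof (rule tendsto_upperbound)
      show "((\<lambda>R. norm (D (H n) R * z ^ n)) \<longlongrightarrow>
          norm (2 * pi * \<i> * rGamma (of_real (\<beta> + \<alpha> * real n)) * z ^ n)) at_top"
        by (intro tendsto_intros H_lim)
      have "norm (D (\<lambda>w. H n w * z ^ n) R) \<le> (2 * \<theta> + 2) * ((1 / 2) ^ n * L)" if "R \<ge> a" for R
      proof (rule path_bound[where g = "\<lambda>w. (z * exp (- of_real \<alpha> * w)) ^ n"])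
        show "((\<lambda>w. H n w * z ^ n) has_field_derivative hankel_kernel \<beta> w * (z * exp (- of_real \<alpha> * w)) ^ n) (at w)" for w
          using DERIV_cmult_right[OF H[of n w], of "z ^ n"] by (simp only: H_term)
        show "norm ((z * exp (- of_real \<alpha> * w)) ^ n) \<le> (1 / 2) ^ n" if "Re w \<ge> a" for w
          unfolding norm_power by (intro power_mono small that) auto
      qed (use that in auto)
      then show "eventually (\<lambda>R. norm (D (H n) R * z ^ n) \<le> (2 * \<theta> + 2) * ((1 / 2) ^ n * L)) at_top"
        by (intro eventually_mono[OF eventually_ge_at_top[of a]]) (simp add: D_def left_diff_distrib)
    qed auto
    have coeff': "norm (rGamma (of_real (\<beta> + \<alpha> * real n)) * z ^ n) \<le> (\<theta> + 1) / pi * L * (1 / 2) ^ n" for n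
      using coeff[of n] by (simp add: norm_mult field_simps)
    have "norm (G n) \<le> c n * ((\<theta> + 1) / pi * L * (1 / 2) ^ n)" for n
      unfolding G_def norm_mult[of "of_real (c n)"] norm_of_real abs_of_nonneg[OF c]
      by (intro mult_left_mono coeff' c)
    then show "eventually (\<lambda>n. norm (G n) \<le> (\<theta> + 1) / pi * L * (c n * (1 / 2) ^ n)) sequentially"
      by (intro always_eventually allI) (simp add: mult_ac)
    show "summable (\<lambda>n. (\<theta> + 1) / pi * L * (c n * (1 / 2) ^ n))"
      by (intro summable_mult binomial(1))
  qed
  have partial: "norm (2 * pi * \<i> * (\<Sum>n<N. G n)) \<le> (2 * \<theta> + 2) * B + (2 * \<theta> + 2) * (e N * L)" for N
  proof (rule tendsto_upperbound)
    define P where "P w = (\<Sum>n<N. of_real (c n) * (H n w * z ^ n))" for w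
    have D_P: "D P R = (\<Sum>n<N. of_real (c n) * (D (H n) R * z ^ n))" for R
      by (simp add: P_def D_def sum_subtractf algebra_simps)
    have "(D P \<longlongrightarrow> (\<Sum>n<N. of_real (c n) * (2 * pi * \<i> * rGamma (of_real (\<beta> + \<alpha> * real n)) * z ^ n))) at_top"
      unfolding D_P by (intro tendsto_intros H_lim)
    moreover have "(\<Sum>n<N. of_real (c n) * (2 * pi * \<i> * rGamma (of_real (\<beta> + \<alpha> * real n)) * z ^ n)) =
        2 * pi * \<i> * (\<Sum>n<N. G n)"
      by (simp add: G_def sum_distrib_left mult_ac)
    ultimately show "((\<lambda>R. norm (D P R)) \<longlongrightarrow> norm (2 * pi * \<i> * (\<Sum>n<N. G n))) at_top"
      by (auto intro: tendsto_norm)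
    have "norm (D P R) \<le> (2 * \<theta> + 2) * B + (2 * \<theta> + 2) * (e N * L)" if "R \<ge> a" for R
    proof -
      have whole: "norm (D F R) \<le> (2 * \<theta> + 2) * B"
        unfolding D_def using that \<open>a \<ge> 0\<close> \<theta> F upper lower vertical
        by (intro hankel_path_bound[where f = ?K and a = 0]) auto
      have rest: "norm (D (\<lambda>w. F w - P w) R) \<le> (2 * \<theta> + 2) * (e N * L)"
      proof (rule path_bound)
        let ?g = "\<lambda>w. (1 - z * exp (- of_real \<alpha> * w)) powr of_real (- \<delta>)
            - (\<Sum>n<N. of_real (c n) * (z * exp (- of_real \<alpha> * w)) ^ n)"
        show "((\<lambda>w. F w - P w) has_field_derivative hankel_kernel \<beta> w * ?g w) (at w)" if "\<bar>Im w\<bar> \<le> \<theta>" for w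
        proof -
          have "(P has_field_derivative (\<Sum>n<N. of_real (c n) * (hankel_kernel (\<beta> + \<alpha> * real n) w * z ^ n))) (at w)"
            unfolding P_def by (intro DERIV_sum DERIV_cmult DERIV_cmult_right H)
          from DERIV_diff[OF F[OF that] this[unfolded H_term]] show ?thesis
            by (simp add: prabhakar_kernel_def right_diff_distrib sum_distrib_left mult_ac)
        qed
        show "norm (?g w) \<le> e N" if "Re w \<ge> a" for w
          unfolding e_def by (intro binomial(2) small that)
      qed (use that e_nonneg in auto)
      have "D P R = D F R - D (\<lambda>w. F w - P w) R" by (simp add: D_def)
      also have "norm \<dots> \<le> norm (D F R) + norm (D (\<lambda>w. F w - P w) R)"
        by (rule norm_triangle_ineq4)
      also note add_mono[OF whole rest]
      finally show ?thesis .
    qed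
    then show "eventually (\<lambda>R. norm (D P R) \<le> (2 * \<theta> + 2) * B + (2 * \<theta> + 2) * (e N * L)) at_top"
      by (rule eventually_mono[OF eventually_ge_at_top[of a]])
  qed auto
  have "norm (2 * pi * \<i> * suminf G) \<le> (2 * \<theta> + 2) * B + (2 * \<theta> + 2) * (0 * L)"
  proof (rule tendsto_le)
    show "(\<lambda>N. (2 * \<theta> + 2) * B + (2 * \<theta> + 2) * (e N * L)) \<longlonglongrightarrow> (2 * \<theta> + 2) * B + (2 * \<theta> + 2) * (0 * L)"
      by (intro tendsto_intros e_lim)
    show "(\<lambda>N. norm (2 * pi * \<i> * (\<Sum>n<N. G n))) \<longlonglongrightarrow> norm (2 * pi * \<i> * suminf G)"
      using summable_LIMSEQ[OF \<open>summable G\<close>] by (intro tendsto_intros)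
  qed (use partial in auto)
  moreover have "prabhakar \<delta> \<alpha> \<beta> z = suminf G"
  proof -
    have "complex_of_real (pochhammer \<delta> n / (fact n * Gamma (\<alpha> * real n + \<beta>))) * z ^ n = G n" for n
      unfolding G_def rGamma_complex_of_real
      by (simp add: c_def rGamma_inverse_Gamma add.commute field_simps)
    then show ?thesis by (simp add: prabhakar_def)
  qed
  ultimately show ?thesis by (simp add: norm_mult field_simps)
qed

section \<open>The bound in the sector\<close>

theorem theorem4p5:
  fixes \<delta> \<alpha> \<beta> \<mu> :: real
  assumes "\<delta> > 0" and "0 < \<alpha>" and "\<alpha> < 2" and "\<beta> > 0"
    and "\<alpha> * pi / 2 < \<mu>" and "\<mu> < min pi (\<alpha> * pi)"
  shows "\<exists>C>0. \<forall>z::complex. \<mu> \<le> \<bar>Arg z\<bar> \<and> \<bar>Arg z\<bar> \<le> pi \<longrightarrow>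
           norm (prabhakar \<delta> \<alpha> \<beta> z) \<le> C / (1 + norm z powr \<delta>)"
proof -
  define m where "m = \<mu> / \<alpha>"
  define \<theta> where "\<theta> = (pi / 2 + m) / 2"
  have m: "pi / 2 < m" "m < pi" "\<alpha> * m = \<mu>"
    using assms by (auto simp: m_def field_simps)
  then have \<theta>: "pi / 2 < \<theta>" "\<theta> < m" "\<theta> < pi" by (auto simp: \<theta>_def)
  then have "\<alpha> * \<theta> < \<mu>" using m assms by (metis mult_strict_left_mono)
  have "cos \<theta> < cos (pi / 2)" using \<theta> by (intro cos_monotone_0_pi) auto
  then have "cos \<theta> < 0" by simp
  then obtain L where L: "L > 0"
    "\<And>x. x \<ge> 0 \<Longrightarrow> norm (hankel_kernel (\<beta> - \<alpha> * \<delta>) (Complex x \<theta>)) \<le> L * exp (- x)"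
    "\<And>x. x \<ge> 0 \<Longrightarrow> norm (hankel_kernel (\<beta> - \<alpha> * \<delta>) (Complex x (- \<theta>))) \<le> L * exp (- x)"
    "\<And>y. norm (hankel_kernel (\<beta> - \<alpha> * \<delta>) (Complex 0 y)) \<le> L"
    using hankel_kernel_decay[of \<theta> 0 "\<beta> - \<alpha> * \<delta>"] by (metis order_refl)
  have cos_lt_1: "cos (\<mu> - t) < 1" if "0 \<le> t" "t < \<mu>" for t
    using cos_monotone_0_pi[of 0 "\<mu> - t"] that assms by simp
  \<comment> \<open>The cosine may be negative, but \<open>norm_one_minus_ge\<close> is about cones of opening at most a right angle to each side.\<close>
  define k where "k = max 0 (cos (\<mu> - \<alpha> * \<theta>))"
  have k: "0 \<le> k" "k < 1"
    using cos_lt_1[of "\<alpha> * \<theta>"] \<open>\<alpha> * \<theta> < \<mu>\<close> \<theta> assms pi_gt_zero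
    by (auto simp: k_def intro!: mult_nonneg_nonneg)
  define A where "A = 2 * sqrt (1 - k) powr (- \<delta>)"
  define C where "C = (\<theta> + 1) / pi * (A * L)"
  have "A > 0" using k by (simp add: A_def)
  then have "C > 0" using L \<theta> pi_gt_zero by (auto simp: C_def intro!: mult_pos_pos divide_pos_pos)
  moreover have "norm (prabhakar \<delta> \<alpha> \<beta> z) \<le> C / (1 + norm z powr \<delta>)" if z: "\<mu> \<le> \<bar>Arg z\<bar>" for z
  proof -
    define Q where "Q = A / (1 + norm z powr \<delta>)"
    have Q: "Q \<ge> 0" using \<open>A > 0\<close> by (simp add: Q_def)
    \<comment> \<open>To the right of the imaginary axis \<open>max 1 \<bar>\<zeta>\<bar>\<close>, with \<open>\<zeta> = z * exp (- \<alpha> * w)\<close>, is at least \<open>exp (- \<alpha> * Re w)\<close>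
       times \<open>1\<close> and times \<open>\<bar>z\<bar>\<close>. The exponential factor lost here only shifts the parameter of the Hankel kernel
       from \<open>\<beta>\<close> to \<open>\<beta> - \<alpha> \<delta>\<close>.\<close>
    have factor: "norm ((1 - z * exp (- of_real \<alpha> * w)) powr of_real (- \<delta>)) \<le> Q * exp (\<alpha> * \<delta> * Re w)"
      if "\<bar>Im w\<bar> \<le> \<theta>" "Re w \<ge> 0" for w
    proof -
      define u where "u = norm (z * exp (- of_real \<alpha> * w))"
      define M where "M = max 1 u"
      have "Re (z * exp (- of_real \<alpha> * w)) \<le> cos (\<mu> - \<alpha> * \<theta>) * u"
        unfolding u_def using z that assms \<open>\<alpha> * \<theta> < \<mu>\<close>
        by (intro Re_times_exp_le) (auto intro!: mult_left_mono)
      also have "\<dots> \<le> k * u"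
        by (intro mult_right_mono) (auto simp: k_def u_def)
      finally have ge: "sqrt (1 - k) * M \<le> norm (1 - z * exp (- of_real \<alpha> * w))"
        unfolding u_def M_def by (intro norm_one_minus_ge k)
      have "norm ((1 - z * exp (- of_real \<alpha> * w)) powr of_real (- \<delta>))
          = norm (1 - z * exp (- of_real \<alpha> * w)) powr (- \<delta>)"
        by (subst norm_powr_real_powr') auto
      also have "\<dots> \<le> (sqrt (1 - k) * M) powr (- \<delta>)"
        using ge k assms by (intro powr_mono2') (auto simp: M_def)
      also have "\<dots> = A / 2 / M powr \<delta>"
        using k by (simp add: A_def M_def powr_mult powr_minus field_simps)
      also have "\<dots> \<le> Q * exp (\<alpha> * \<delta> * Re w)"
      proof -
        have "norm z = u * exp (\<alpha> * Re w)"
          by (simp add: u_def norm_mult mult.assoc flip: exp_add)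
        then have "norm z powr \<delta> = u powr \<delta> * exp (\<alpha> * \<delta> * Re w)"
          by (simp add: powr_mult u_def exp_powr_real mult_ac)
        also have "\<dots> \<le> M powr \<delta> * exp (\<alpha> * \<delta> * Re w)"
          using assms by (intro mult_right_mono powr_mono2) (auto simp: u_def M_def)
        finally have 1: "norm z powr \<delta> \<le> M powr \<delta> * exp (\<alpha> * \<delta> * Re w)" .
        have "1 * 1 \<le> M powr \<delta> * exp (\<alpha> * \<delta> * Re w)"
          using assms that by (intro mult_mono ge_one_powr_ge_zero) (auto simp: M_def)
        with 1 have "1 + norm z powr \<delta> \<le> 2 * M powr \<delta> * exp (\<alpha> * \<delta> * Re w)" by simp
        then have "A * (1 + norm z powr \<delta>) \<le> A * (2 * M powr \<delta> * exp (\<alpha> * \<delta> * Re w))"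
          using \<open>A > 0\<close> by simp
        moreover have "M powr \<delta> > 0" "1 + norm z powr \<delta> > 0"
          by (auto simp: M_def add_pos_nonneg)
        ultimately show ?thesis by (simp add: Q_def field_simps)
      qed
      finally show ?thesis .
    qed
    have kernel: "norm (prabhakar_kernel \<delta> \<alpha> \<beta> z w) \<le> Q * norm (hankel_kernel (\<beta> - \<alpha> * \<delta>) w)"
      if "\<bar>Im w\<bar> \<le> \<theta>" "Re w \<ge> 0" for w
    proof -
      have "norm (prabhakar_kernel \<delta> \<alpha> \<beta> z w) \<le> norm (hankel_kernel \<beta> w) * (Q * exp (\<alpha> * \<delta> * Re w))"
        unfolding prabhakar_kernel_def norm_mult by (intro mult_left_mono factor that) auto
      also have "\<dots> = Q * norm (hankel_kernel (\<beta> - \<alpha> * \<delta>) w)"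
        using hankel_kernel_shift[of \<beta> "- (\<alpha> * \<delta>)" w] by (simp add: norm_mult)
      finally show ?thesis .
    qed
    have off_cut: "1 - z * exp (- of_real \<alpha> * w) \<notin> \<real>\<^sub>\<le>\<^sub>0" if "\<bar>Im w\<bar> < m" for w
    proof
      let ?\<zeta> = "z * exp (- of_real \<alpha> * w)"
      assume "1 - ?\<zeta> \<in> \<real>\<^sub>\<le>\<^sub>0"
      then have 1: "Re ?\<zeta> \<ge> 1" "Im ?\<zeta> = 0"
        by (auto simp: complex_nonpos_Reals_iff)
      then have norm: "norm ?\<zeta> = Re ?\<zeta>" by (simp add: cmod_eq_Re)
      have lt: "\<alpha> * \<bar>Im w\<bar> < \<mu>" using that m assms by (metis mult_strict_left_mono)
      have "Re ?\<zeta> \<le> cos (\<mu> - \<alpha> * \<bar>Im w\<bar>) * norm ?\<zeta>"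
        using z assms lt by (intro Re_times_exp_le) auto
      also have "\<dots> < 1 * norm ?\<zeta>"
        using 1 norm lt assms by (intro mult_strict_right_mono cos_lt_1) auto
      finally show False using norm by simp
    qed
    have "norm (prabhakar \<delta> \<alpha> \<beta> z) \<le> (\<theta> + 1) / pi * (Q * L)"
    proof (rule norm_prabhakar_le[where m = m])
      show "norm (prabhakar_kernel \<delta> \<alpha> \<beta> z (Complex x \<theta>)) \<le> Q * L * exp (- x)" if "x \<ge> 0" for x
        using order_trans[OF kernel[of "Complex x \<theta>"] mult_left_mono[OF L(2)[OF that] Q]] that \<theta>
        by (simp add: mult.assoc)
      show "norm (prabhakar_kernel \<delta> \<alpha> \<beta> z (Complex x (- \<theta>))) \<le> Q * L * exp (- x)" if "x \<ge> 0" for x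
        using order_trans[OF kernel[of "Complex x (- \<theta>)"] mult_left_mono[OF L(3)[OF that] Q]] that \<theta>
        by (simp add: mult.assoc)
      show "norm (prabhakar_kernel \<delta> \<alpha> \<beta> z (Complex 0 y)) \<le> Q * L" if "\<bar>y\<bar> \<le> \<theta>" for y
        using order_trans[OF kernel[of "Complex 0 y"] mult_left_mono[OF L(4) Q]] that by simp
    qed (use assms \<theta> off_cut in auto)
    also have "\<dots> = C / (1 + norm z powr \<delta>)" by (simp add: Q_def C_def)
    finally show ?thesis .
  qed
  ultimately show ?thesis by blast
qed

end
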